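(* There is exactly one non-trivial separable group topology on $S_\infty$.
   Context: $S_\infty$ is the group of all permutations of $\mathbb N$. A group topology is a topology making multiplication and inversion continuous; it is not assumed Hausdorff. The trivial topology is $\{\emptyset,S_\infty\}$. Separable means having a countable dense subset. *)

theory Defs
  imports "HOL-Analysis.Analysis" "HOL-Algebra.Bij"
begin

definition group_topology :: "('a, 'b) monoid_scheme \<Rightarrow> 'a topology \<Rightarrow> bool" where
  "group_topology G T \<longleftrightarrow>
     topspace T = carrier G \<and>
     continuous_map (prod_topology T T) T (\<lambda>(x, y). x \<otimes>\<^bsub>G\<^esub> y) \<and>
     continuous_map T T (\<lambda>x. inv\<^bsub>G\<^esub> x)"

text \<open>The library abbreviation \<open>trivial_topology\<close> denotes the topology of the empty
  space, so the coarsest topology on a given carrier gets a different name.\<close>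

definition indiscrete_space :: "'a topology \<Rightarrow> bool" where
  "indiscrete_space X \<longleftrightarrow> {U. openin X U} = {{}, topspace X}"

text \<open>Since the underlying set is all of \<open>nat\<close>, extensionality in \<open>BijGroup\<close> is no
  restriction, and the product is ordinary composition of functions.\<close>

abbreviation S_infinity :: "(nat \<Rightarrow> nat) monoid" where
  "S_infinity \<equiv> BijGroup (UNIV :: nat set)"

end

theory Submission
  imports Defs "HOL-Combinatorics.Permutations"
begin

text \<open>The unique topology is the one of pointwise convergence, for which the pointwise stabilizers
  of finite sets form a neighbourhood base of the identity. It is a group topology; it is separable
  because only countably many finite partial injections have to be extended to permutations.
  Conversely, a non-trivial separable group topology \<open>T\<close> is compared with it in both directions.

  \<^emph>\<open>\<open>T\<close> is coarser\<close> (\<open>nbhd_contains_stabilizer\<close>). Separability enters only in the following form: for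
  every neighbourhood \<open>W\<close> of the identity the permutations can be coloured with countably many
  colours so that \<open>g\<close> and \<open>h\<close> of equal colour satisfy \<open>inv g \<circ> h \<in> W\<close>. Three arguments
  exploit such a colouring. Diagonalizing against the colours over a partition into infinitely many
  infinite sets gives an infinite set \<open>A\<close> with infinite complement on which \<open>W\<close> induces all
  permutations (\<open>countable_colouring_full_moiety\<close>). Using this twice, with commutators, cancels what
  happens off \<open>A\<close>, so that a bounded power of \<open>W\<close> contains all permutations supported on a suitable
  \<open>A\<close> (\<open>moiety_of_commutators\<close>). Since there are uncountably many pairwise almost disjoint sets of
  naturals, some \<open>w \<in> W\<close> moves \<open>A\<close> to a set that covers almost all of the complement of \<open>A\<close>
  (\<open>moiety_translate_almost_covers\<close>). Finally, every permutation of \<open>A \<union> w ` A\<close> is a product of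
  four permutations supported on \<open>A\<close> or on \<open>w ` A\<close> (\<open>permutation_factorization\<close>).

  \<^emph>\<open>\<open>T\<close> is finer\<close> (\<open>nbhd_fixes_finite_set\<close>). Let \<open>V\<close> be so small that the product of many copies of
  it is not the whole group, and let it contain the stabilizer of the finite set \<open>F\<close>. If some \<open>v \<in> V\<close>
  made \<open>v ` F\<close> disjoint from \<open>F\<close>, the stabilizers of \<open>F\<close> and of \<open>v ` F\<close> would generate
  everything in four factors; so every \<open>v \<in> V\<close> maps a point of \<open>F\<close> into \<open>F\<close>. By conjugation and a
  greedy choice of points there is then a bound \<open>m\<close> such that, for each finite \<open>E\<close>, all sufficiently
  small permutations move at most \<open>m\<close> points of \<open>E\<close>. The least such \<open>m\<close> is \<open>0\<close>: otherwise
  multiplying a permutation that moves \<open>m\<close> points by a conjugate that moves \<open>m\<close> other points would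
  move \<open>2 * m\<close> points.

  Throughout, a \<^emph>\<open>moiety\<close> is an infinite set of naturals whose complement is infinite.\<close>

unbundle no m_inv_syntax \<comment> \<open>so that \<open>inv\<close> is the inverse of a function\<close>

section \<open>Infinite sets of natural numbers\<close>

lemma infinite_nat_sets_bij_betw:
  fixes A B :: "nat set"
  assumes "infinite A" "infinite B"
  obtains f where "bij_betw f A B"
  using bij_betw_trans[OF bij_betw_inv_into[OF bij_enumerate[OF assms(1)]] bij_enumerate[OF assms(2)]]
  by (rule that)

lemma infinite_nat_enumeration:
  fixes I :: "nat set"
  assumes "infinite I" "infinite (UNIV :: 'b::countable set)"
  obtains \<phi> :: "'b::countable \<Rightarrow> nat" where "bij_betw \<phi> UNIV I"
proof -
  define R where "R = range (to_nat :: 'b \<Rightarrow> nat)"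
  have R: "bij_betw to_nat (UNIV :: 'b set) R"
    by (simp add: bij_betw_def R_def)
  then have "infinite R" using assms(2) bij_betw_finite by blast
  then obtain f where "bij_betw f R I" using infinite_nat_sets_bij_betw assms(1) by blast
  from bij_betw_trans[OF R this] show ?thesis by (rule that)
qed

lemma infinite_nat_split:
  fixes I :: "nat set"
  assumes "infinite I"
  obtains j :: "nat \<Rightarrow> nat" where "inj j" "range j \<subseteq> I" "infinite (range j)" "infinite (I - range j)"
proof -
  obtain \<phi> :: "nat \<times> nat \<Rightarrow> nat" where \<phi>: "bij_betw \<phi> UNIV I"
    using infinite_nat_enumeration[OF assms] by (metis finite_prod infinite_UNIV_nat)
  have "inj \<phi>" "range \<phi> = I" using \<phi> by (auto simp: bij_betw_def)
  let ?j = "\<lambda>k. \<phi> (0, k)" and ?j' = "\<lambda>k. \<phi> (1, k)"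
  have "inj ?j" "inj ?j'" using \<open>inj \<phi>\<close> by (auto intro!: injI simp: inj_eq)
  moreover have "range ?j' \<subseteq> I - range ?j"
    using \<open>range \<phi> = I\<close> \<open>inj \<phi>\<close> by (auto simp: inj_eq)
  ultimately have "infinite (I - range ?j)"
    using finite_imageD finite_subset infinite_UNIV_nat by metis
  moreover have "infinite (range ?j)" using \<open>inj ?j\<close> finite_imageD infinite_UNIV_nat by blast
  ultimately show ?thesis using that[of ?j] \<open>inj ?j\<close> \<open>range \<phi> = I\<close> by auto
qed

text \<open>The two infinite remainders have the same cardinality, so any bijection between them
  completes \<open>e\<close>.\<close>

lemma injection_extends_to_permutation:
  fixes A :: "nat set"
  assumes "X \<subseteq> A" "inj_on e X" "e ` X \<subseteq> A" "infinite (A - X)" "infinite (A - e ` X)"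
  obtains p where "p permutes A" "\<And>x. x \<in> X \<Longrightarrow> p x = e x"
proof -
  obtain b where b: "bij_betw b (A - X) (A - e ` X)"
    using infinite_nat_sets_bij_betw[OF assms(4,5)] by blast
  let ?p = "\<lambda>x. if x \<in> X then e x else if x \<in> A then b x else x"
  have "bij_betw ?p (X \<union> (A - X)) (e ` X \<union> (A - e ` X))"
  proof (rule bij_betw_combine)
    show "bij_betw ?p X (e ` X)"
      using assms(2) by (auto simp: bij_betw_def inj_on_def)
    show "bij_betw ?p (A - X) (A - e ` X)"
      using b by (rule bij_betw_cong[THEN iffD1, rotated]) auto
  qed auto
  moreover have "X \<union> (A - X) = A" "e ` X \<union> (A - e ` X) = A" using assms(1,3) by auto
  ultimately have "?p permutes A" using assms(1) by (intro bij_imp_permutes) auto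
  then show ?thesis using that[of ?p] by auto
qed

lemma moieties_conjugate:
  fixes A B :: "nat set"
  assumes "infinite A" "infinite (- A)" "infinite B" "infinite (- B)"
  obtains g where "bij g" "g ` A = B"
proof -
  obtain f where f: "bij_betw f A B" using infinite_nat_sets_bij_betw assms(1,3) by blast
  have "inj_on f A" "infinite (UNIV - A)" "infinite (UNIV - f ` A)"
    using f assms by (auto simp: bij_betw_def Compl_eq_Diff_UNIV)
  then obtain g where "g permutes UNIV" "\<And>x. x \<in> A \<Longrightarrow> g x = f x"
    using injection_extends_to_permutation[of A UNIV f] by auto
  moreover then have "g ` A = B" using f by (auto simp: bij_betw_def image_def)
  ultimately show ?thesis using that permutes_bij by blast
qed

section \<open>Permutations induced by one colour class\<close>

lemma permutation_glue:
  assumes "\<And>n. h n permutes {x \<in> B. idx x = n}"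
  shows "(\<lambda>x. if x \<in> B then h (idx x) x else x) permutes B"
proof (rule bij_imp_permutes)
  let ?H = "\<lambda>x. if x \<in> B then h (idx x) x else x"
  let ?K = "\<lambda>x. if x \<in> B then inv (h (idx x)) x else x"
  have mem: "h (idx x) x \<in> B \<and> idx (h (idx x) x) = idx x" if "x \<in> B" for x
    using permutes_in_image[OF assms[of "idx x"], of x] that by auto
  have mem': "inv (h (idx x)) x \<in> B \<and> idx (inv (h (idx x)) x) = idx x" if "x \<in> B" for x
    using permutes_in_image[OF permutes_inv[OF assms[of "idx x"]], of x] that by auto
  show "bij_betw ?H B B"
    by (rule bij_betw_byWitness[where f' = ?K])
      (auto simp: mem mem' permutes_inverses[OF assms])
qed auto

text \<open>Cut \<open>B\<close> into infinitely many infinite pieces \<open>P n\<close>. If for each \<open>n\<close> some permutation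
  \<open>h n\<close> of \<open>P n\<close> were not induced by a permutation of colour \<open>n\<close>, the permutation glued
  from all \<open>h n\<close> would have no colour. So for some \<open>n\<close> the colour \<open>n\<close> induces every permutation of
  \<open>P n\<close>, in particular the identity, and dividing by a permutation that induces the identity
  leads into \<open>W\<close>. The set \<open>B\<close> is arbitrary because the lemma will be applied a second time
  inside the moiety that it produces.\<close>
lemma countable_colouring_full_moiety:
  fixes c :: "(nat \<Rightarrow> nat) \<Rightarrow> nat" and B :: "nat set"
  assumes col: "\<And>g h. bij g \<Longrightarrow> bij h \<Longrightarrow> c g = c h \<Longrightarrow> inv g \<circ> h \<in> W"
    and B: "infinite B"
  obtains A where "A \<subseteq> B" "infinite A" "infinite (B - A)"
    "\<And>h. h permutes A \<Longrightarrow> \<exists>w\<in>W. w permutes B \<and> (\<forall>x\<in>A. w x = h x)"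
proof -
  obtain \<phi> :: "nat \<times> nat \<Rightarrow> nat" where \<phi>: "bij_betw \<phi> UNIV B"
    using infinite_nat_enumeration[OF B] by (metis finite_prod infinite_UNIV_nat)
  then have inj: "inj \<phi>" and ran: "range \<phi> = B" by (auto simp: bij_betw_def)
  define idx where "idx x = fst (inv \<phi> x)" for x
  define P where "P n = {x \<in> B. idx x = n}" for n
  have idx: "idx (\<phi> (n, k)) = n" for n k using inj by (simp add: idx_def)
  have Pinf: "infinite (P n)" for n
  proof -
    have "inj (\<lambda>k. \<phi> (n, k))" using inj by (auto intro!: injI simp: inj_eq)
    moreover have "range (\<lambda>k. \<phi> (n, k)) \<subseteq> P n" using ran by (auto simp: P_def idx)
    ultimately show ?thesis using finite_imageD finite_subset infinite_UNIV_nat by metis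
  qed
  have "\<exists>n. \<forall>h. h permutes P n \<longrightarrow> (\<exists>g. g permutes B \<and> c g = n \<and> (\<forall>x\<in>P n. g x = h x))"
  proof (rule ccontr)
    assume "\<not> ?thesis"
    then obtain h where h: "\<And>n. h n permutes P n"
      and bad: "\<And>n g. g permutes B \<Longrightarrow> c g = n \<Longrightarrow> \<exists>x\<in>P n. g x \<noteq> h n x" by metis
    let ?H = "\<lambda>x. if x \<in> B then h (idx x) x else x"
    have "?H permutes B" using permutation_glue[of h B idx] h by (simp add: P_def)
    then show False using bad[of ?H "c ?H"] by (auto simp: P_def)
  qed
  then obtain n where n: "\<And>h. h permutes P n \<Longrightarrow>
      \<exists>g. g permutes B \<and> c g = n \<and> (\<forall>x\<in>P n. g x = h x)" by blast
  obtain g0 where g0: "g0 permutes B" "c g0 = n" "\<forall>x\<in>P n. g0 x = x"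
    using n[of id] permutes_id by auto
  show ?thesis
  proof (rule that[of "P n"])
    show "P n \<subseteq> B" by (auto simp: P_def)
    show "infinite (P n)" by (rule Pinf)
    have "P (Suc n) \<subseteq> B - P n" by (auto simp: P_def)
    then show "infinite (B - P n)" using Pinf finite_subset by blast
    fix h assume h: "h permutes P n"
    then obtain g where g: "g permutes B" "c g = n" "\<forall>x\<in>P n. g x = h x" using n by blast
    have "inv g0 \<circ> g \<in> W" using col[of g0 g] g0 g permutes_bij by auto
    moreover have "inv g0 \<circ> g permutes B"
      using g0 g permutes_inv permutes_compose by blast
    moreover have "(inv g0 \<circ> g) x = h x" if "x \<in> P n" for x
    proof -
      have "h x \<in> P n" using that permutes_in_image[OF h, of x] by simp
      then show ?thesis using g g0 that permutes_inv_eq[OF g0(1)] by auto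
    qed
    ultimately show "\<exists>w\<in>W. w permutes B \<and> (\<forall>x\<in>P n. w x = h x)" by blast
  qed
qed

text \<open>Arrange \<open>A\<close> as a two-sided sequence of copies of \<open>A1\<close>. Let \<open>a\<close> shift each copy to the
  next one, and let \<open>b\<close> act as \<open>d\<close> on every copy with non-negative index. The conjugate of \<open>b\<close>
  by \<open>a\<close> acts as \<open>d\<close> on the copies with positive index only, so the commutator of \<open>b\<close> and
  \<open>a\<close> is \<open>d\<close> on the copy with index \<open>0\<close>, which is \<open>A1\<close>.\<close>
lemma permutation_is_commutator:
  fixes A :: "nat set"
  assumes "infinite A"
  obtains A1 where "A1 \<subseteq> A" "infinite A1" "infinite (A - A1)"
    "\<And>d. d permutes A1 \<Longrightarrow> \<exists>a b. a permutes A \<and> b permutes A \<and> d \<circ> (a \<circ> b) = b \<circ> a"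
proof -
  obtain \<phi> :: "int \<times> nat \<Rightarrow> nat" where \<phi>: "bij_betw \<phi> UNIV A"
    using infinite_nat_enumeration[OF assms] by (metis finite_prod infinite_UNIV_nat)
  then have inj: "inj \<phi>" and ran: "range \<phi> = A" by (auto simp: bij_betw_def)
  have eqphi: "\<phi> p = \<phi> q \<longleftrightarrow> p = q" for p q using inj by (rule inj_eq)
  have memA: "\<phi> p \<in> A" for p using ran by auto
  define A1 where "A1 = range (\<lambda>k. \<phi> (0, k))"
  have inf: "infinite (range (\<lambda>k. \<phi> (i, k)))" for i
    by (rule range_inj_infinite) (use inj in \<open>auto intro!: injI simp: inj_eq\<close>)
  have lift: "\<exists>a. a permutes A \<and> (\<forall>p. a (\<phi> p) = \<phi> (s p))" if "bij s" for s
  proof -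
    let ?a = "\<lambda>x. if x \<in> A then \<phi> (s (inv \<phi> x)) else x"
    let ?a' = "\<lambda>x. if x \<in> A then \<phi> (inv s (inv \<phi> x)) else x"
    have "bij_betw ?a A A"
      by (rule bij_betw_byWitness[where f' = ?a'])
        (use that ran inj in \<open>auto simp: bij_is_inj bij_is_surj surj_f_inv_f f_inv_into_f\<close>)
    then have "?a permutes A" by (rule bij_imp_permutes) auto
    then show ?thesis using inj ran by (intro exI[of _ ?a]) auto
  qed
  show ?thesis
  proof (rule that[of A1])
    show "A1 \<subseteq> A" using ran by (auto simp: A1_def)
    show "infinite A1" unfolding A1_def by (rule inf)
    have "range (\<lambda>k. \<phi> (1, k)) \<subseteq> A - A1" using ran eqphi by (auto simp: A1_def)
    then show "infinite (A - A1)" using inf finite_subset by blast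
    fix d assume d: "d permutes A1"
    \<comment> \<open>\<open>\<delta>\<close> is \<open>d\<close> in the coordinates of the copy with index \<open>0\<close>; \<open>s\<close> and \<open>t\<close> are \<open>a\<close> and \<open>b\<close>.\<close>
    define \<delta> where "\<delta> k = (THE l. d (\<phi> (0, k)) = \<phi> (0, l))" for k
    have \<delta>: "d (\<phi> (0, k)) = \<phi> (0, \<delta> k)" for k
    proof -
      have "d (\<phi> (0, k)) \<in> A1" using permutes_in_image[OF d] by (auto simp: A1_def)
      then obtain l where "d (\<phi> (0, k)) = \<phi> (0, l)" by (auto simp: A1_def)
      then show ?thesis unfolding \<delta>_def by (auto simp: eqphi)
    qed
    have bij\<delta>: "bij \<delta>"
    proof (rule bijI)
      show "inj \<delta>"
      proof (rule injI)
        fix k l assume "\<delta> k = \<delta> l"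
        then have "d (\<phi> (0, k)) = d (\<phi> (0, l))" by (simp add: \<delta>)
        then show "k = l" using permutes_inj[OF d] eqphi by (simp add: inj_eq)
      qed
      have "\<exists>k. l = \<delta> k" for l
      proof -
        have "\<phi> (0, l) \<in> d ` A1" using permutes_image[OF d] by (auto simp: A1_def)
        then obtain k where "\<phi> (0, l) = d (\<phi> (0, k))" by (auto simp: A1_def)
        then show ?thesis by (auto simp: \<delta> eqphi)
      qed
      then show "surj \<delta>" by blast
    qed
    define s where "s = (\<lambda>(i::int, k::nat). (i + 1, k))"
    define t where "t = (\<lambda>(i::int, k). if 0 \<le> i then (i, \<delta> k) else (i, k))"
    have "bij s" by (rule o_bij[of "\<lambda>(i, k). (i - 1, k)"]) (auto simp: s_def fun_eq_iff)
    moreover have "bij t"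
      by (rule o_bij[of "\<lambda>(i, k). if 0 \<le> i then (i, inv \<delta> k) else (i, k)"])
        (use bij\<delta> in \<open>auto simp: t_def fun_eq_iff bij_is_inj bij_is_surj surj_f_inv_f\<close>)
    ultimately obtain a b where a: "a permutes A" "\<And>p. a (\<phi> p) = \<phi> (s p)"
      and b: "b permutes A" "\<And>p. b (\<phi> p) = \<phi> (t p)" using lift by metis
    have "d (a (b x)) = b (a x)" for x
    proof (cases "x \<in> A")
      case True
      then obtain i k where x: "x = \<phi> (i, k)" using ran by auto
      have d1: "d (\<phi> (j, l)) = \<phi> (j, l)" if "j \<noteq> 0" for j l
      proof -
        have "\<phi> (j, l) \<notin> A1" using that by (auto simp: A1_def eqphi)
        then show ?thesis by (rule permutes_not_in[OF d])
      qed
      consider "0 \<le> i" | "i = -1" | "i < -1" by linarith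
      then show ?thesis
        by cases (auto simp: x a b s_def t_def d1 \<delta>)
    next
      case False
      moreover then have "x \<notin> A1" using \<open>A1 \<subseteq> A\<close> by auto
      ultimately show ?thesis using permutes_not_in a(1) b(1) d by metis
    qed
    then show "\<exists>a b. a permutes A \<and> b permutes A \<and> d \<circ> (a \<circ> b) = b \<circ> a"
      using a b by (auto simp: fun_eq_iff)
  qed
qed

text \<open>A permutation induced on \<open>A\<close> by \<open>W\<close> is uncontrolled off \<open>A\<close>. A commutator \<open>d\<close> of \<open>a\<close> and
  \<open>b\<close> avoids the problem: \<open>u\<close> realizes \<open>a\<close> on \<open>A\<close> and \<open>v\<close> realizes \<open>b\<close> on a smaller set
  \<open>A0\<close> while being supported on \<open>A\<close>. Outside \<open>A0\<close> the supports of \<open>u\<close> and \<open>v\<close> are disjoint, so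
  \<open>u\<close> and \<open>v\<close> commute there and their commutator is exactly \<open>d\<close>.\<close>
lemma moiety_of_commutators:
  fixes c :: "(nat \<Rightarrow> nat) \<Rightarrow> nat"
  assumes col: "\<And>g h. bij g \<Longrightarrow> bij h \<Longrightarrow> c g = c h \<Longrightarrow> inv g \<circ> h \<in> W"
  obtains A where "infinite A" "infinite (- A)"
    "\<And>d. d permutes A \<Longrightarrow> \<exists>a\<in>W. \<exists>b\<in>W. bij a \<and> bij b \<and> d = b \<circ> a \<circ> (inv b \<circ> inv a)"
proof -
  obtain A where A: "infinite A" "infinite (UNIV - A)"
    and fullA: "\<And>h. h permutes A \<Longrightarrow> \<exists>w\<in>W. w permutes UNIV \<and> (\<forall>x\<in>A. w x = h x)"
    using countable_colouring_full_moiety[of c W UNIV] col by (metis infinite_UNIV_nat)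
  obtain A0 where A0: "A0 \<subseteq> A" "infinite A0" "infinite (A - A0)"
    and fullA0: "\<And>h. h permutes A0 \<Longrightarrow> \<exists>w\<in>W. w permutes A \<and> (\<forall>x\<in>A0. w x = h x)"
    using countable_colouring_full_moiety[of c W A] col A by metis
  obtain A1 where A1: "A1 \<subseteq> A0" "infinite A1" "infinite (A0 - A1)"
    and com: "\<And>d. d permutes A1 \<Longrightarrow> \<exists>a b. a permutes A0 \<and> b permutes A0 \<and> d \<circ> (a \<circ> b) = b \<circ> a"
    using permutation_is_commutator[OF A0(2)] by metis
  show ?thesis
  proof (rule that[of A1])
    show "infinite A1" by fact
    show "infinite (- A1)" using A1(3) finite_subset[of "A0 - A1" "- A1"] by auto
    fix d assume d: "d permutes A1"
    then obtain a b where a: "a permutes A0" and b: "b permutes A0"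
      and dab: "d \<circ> (a \<circ> b) = b \<circ> a" using com by blast
    obtain u where u: "u \<in> W" "u permutes UNIV" "\<And>x. x \<in> A \<Longrightarrow> u x = a x"
      using fullA[OF permutes_subset[OF a A0(1)]] by blast
    obtain v where v: "v \<in> W" "v permutes A" "\<And>x. x \<in> A0 \<Longrightarrow> v x = b x"
      using fullA0[OF b] by blast
    have buv: "bij u" "bij v" using u v permutes_bij by blast+
    have injv: "v x \<in> A0 \<longleftrightarrow> x \<in> A0" for x
    proof -
      have "v ` A0 = b ` A0" using v(3) by (auto simp: image_def)
      then have "v ` A0 = A0" using permutes_image[OF b] by simp
      then show ?thesis using inj_image_mem_iff[OF bij_is_inj[OF buv(2)], of x A0] by simp
    qed
    have uA: "u x \<in> A \<longleftrightarrow> x \<in> A" for x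
    proof -
      have "u ` A = a ` A" using u(3) by (auto simp: image_def)
      then have "u ` A = A" using permutes_image[OF permutes_subset[OF a A0(1)]] by simp
      then show ?thesis using inj_image_mem_iff[OF bij_is_inj[OF buv(1)], of x A] by simp
    qed
    have "d (u (v x)) = v (u x)" for x
    proof -
      consider "x \<in> A0" | "x \<in> A - A0" | "x \<notin> A" by blast
      then show ?thesis
      proof cases
        case 1
        then have "b x \<in> A0" "a x \<in> A0"
          by (simp_all add: permutes_in_image[OF a] permutes_in_image[OF b])
        moreover have "d (a (b x)) = b (a x)" using dab by (metis comp_apply)
        ultimately show ?thesis using 1 A0(1) u(3) v(3) by (simp add: subset_iff)
      next
        case 2
        then have vx: "v x \<in> A - A0" using injv permutes_in_image[OF v(2)] by auto
        then have "u (v x) = v x" using u(3) permutes_not_in[OF a] by auto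
        moreover have "u x = x" using 2 u(3) permutes_not_in[OF a] by auto
        moreover have "d (v x) = v x" using vx A1(1) permutes_not_in[OF d] by auto
        ultimately show ?thesis by simp
      next
        case 3
        then have "v x = x" "v (u x) = u x" using uA permutes_not_in[OF v(2)] by auto
        moreover have "d (u x) = u x" using 3 uA A0(1) A1(1) permutes_not_in[OF d, of "u x"] by auto
        ultimately show ?thesis by simp
      qed
    qed
    then have "d \<circ> (u \<circ> v) = v \<circ> u" by (auto simp: fun_eq_iff)
    then have "d \<circ> ((u \<circ> v) \<circ> inv (u \<circ> v)) = v \<circ> u \<circ> inv (u \<circ> v)"
      by (simp only: comp_assoc[symmetric])
    moreover have "(u \<circ> v) \<circ> inv (u \<circ> v) = id"
      using bij_is_surj[OF bij_comp[OF buv(2,1)]] by (simp only: surj_iff)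
    moreover have "inv (u \<circ> v) = inv v \<circ> inv u" using o_inv_distrib[OF buv] .
    ultimately have "d = v \<circ> u \<circ> (inv v \<circ> inv u)" by simp
    then show "\<exists>a\<in>W. \<exists>b\<in>W. bij a \<and> bij b \<and> d = b \<circ> a \<circ> (inv b \<circ> inv a)"
      using u v buv by blast
  qed
qed

section \<open>A moiety and its translate\<close>

text \<open>Two different sequences share only finitely many prefixes, so the branches of the binary tree form an almost disjoint family of the size of the continuum.\<close>
definition branch :: "(nat \<Rightarrow> bool) \<Rightarrow> nat set" where
  "branch x = range (\<lambda>n. to_nat (map x [0..<n]))"

lemma infinite_branch: "infinite (branch x)"
proof -
  have "inj (\<lambda>n. to_nat (map x [0..<n]))"
    by (rule injI) (metis diff_zero inj_to_nat injD length_map length_upt)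
  then show ?thesis unfolding branch_def by (rule range_inj_infinite)
qed

lemma branches_almost_disjoint:
  assumes "x \<noteq> y"
  shows "finite (branch x \<inter> branch y)"
proof -
  obtain k where k: "x k \<noteq> y k" using assms by auto
  have "branch x \<inter> branch y \<subseteq> (\<lambda>n. to_nat (map x [0..<n])) ` {..k}"
  proof
    fix z assume "z \<in> branch x \<inter> branch y"
    then obtain n m where n: "z = to_nat (map x [0..<n])" and m: "z = to_nat (map y [0..<m])"
      unfolding branch_def by blast
    then have eq: "map x [0..<n] = map y [0..<m]" by simp
    then have "n = m" by (metis diff_zero length_map length_upt)
    have "n \<le> k"
    proof (rule ccontr)
      assume "\<not> n \<le> k"
      then have "map x [0..<n] ! k = map y [0..<m] ! k" using eq by simp
      then show False using k \<open>\<not> n \<le> k\<close> \<open>n = m\<close> by simp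
    qed
    then show "z \<in> (\<lambda>n. to_nat (map x [0..<n])) ` {..k}" using n by auto
  qed
  then show ?thesis using finite_subset by blast
qed

text \<open>A third branch lies almost entirely in the complement.\<close>
lemma infinite_Compl_branches: "infinite (- (branch x \<union> branch y))"
proof
  assume fin: "finite (- (branch x \<union> branch y))"
  have "infinite (UNIV :: (nat \<Rightarrow> bool) set)"
    using finite_fun_UNIVD1[where 'a = nat and 'b = bool] by (auto simp: card_UNIV_bool)
  then obtain z where "z \<notin> {x, y}" by (metis ex_new_if_finite finite.emptyI finite.insertI)
  then have "finite (branch z \<inter> branch x)" "finite (branch z \<inter> branch y)"
    using branches_almost_disjoint by auto
  moreover have "branch z \<subseteq> (branch z \<inter> branch x) \<union> (branch z \<inter> branch y) \<union> - (branch x \<union> branch y)"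
    by auto
  ultimately show False using fin infinite_branch by (meson finite_UnI finite_subset)
qed

text \<open>Choose for every branch a permutation \<open>g x\<close> that maps \<open>A\<close> onto its complement. There are more
  branches than colours, so two of these permutations have the same colour and \<open>w = inv (g x) \<circ> g y\<close>
  lies in \<open>W\<close>. Applying \<open>g x\<close> turns \<open>A\<close> and \<open>w ` A\<close> into the complements of two almost disjoint
  sets.\<close>
lemma moiety_translate_almost_covers:
  fixes c :: "(nat \<Rightarrow> nat) \<Rightarrow> nat" and A :: "nat set"
  assumes col: "\<And>g h. bij g \<Longrightarrow> bij h \<Longrightarrow> c g = c h \<Longrightarrow> inv g \<circ> h \<in> W"
    and A: "infinite A" "infinite (- A)"
  obtains w where "w \<in> W" "bij w" "finite (- (A \<union> w ` A))" "infinite (A \<inter> w ` A)"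
proof -
  have "\<exists>g. bij g \<and> g ` A = - branch x" for x
  proof -
    have "infinite (- branch x)" using infinite_Compl_branches[of x x] by simp
    then show ?thesis using moieties_conjugate[OF A, of "- branch x"] infinite_branch
      by (metis double_complement)
  qed
  then obtain g where g: "\<And>x. bij (g x)" "\<And>x. g x ` A = - branch x" by metis
  have "\<not> inj (\<lambda>x. c (g x))"
  proof
    assume "inj (\<lambda>x. c (g x))"
    then obtain f :: "nat \<Rightarrow> nat \<Rightarrow> bool" where "surj f"
      by (metis inj_imp_surj_inv)
    \<comment> \<open>Cantor's diagonal argument\<close>
    then obtain n where "f n = (\<lambda>k. \<not> f k k)" by (metis surjD)
    then show False by meson
  qed
  then obtain x y where xy: "x \<noteq> y" "c (g x) = c (g y)" by (auto simp: inj_on_def)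
  define w where "w = inv (g x) \<circ> g y"
  have surj: "surj (g x)" and inj: "inj (g x)"
    using g(1)[of x] by (simp_all add: bij_is_surj bij_is_inj)
  have w: "bij w" unfolding w_def by (intro bij_comp bij_imp_bij_inv g(1))
  have wW: "w \<in> W" unfolding w_def by (rule col[OF g(1) g(1) xy(2)])
  have gw: "g x ` w ` A = - branch y"
    unfolding w_def image_comp[symmetric] g(2) using surj by (rule image_f_inv_f)
  have "g x ` (- (A \<union> w ` A)) = branch x \<inter> branch y"
    unfolding bij_image_Compl_eq[OF g(1)] image_Un gw g(2) by simp
  then have "finite (g x ` (- (A \<union> w ` A)))" using branches_almost_disjoint xy by simp
  then have "finite (- (A \<union> w ` A))"
    by (rule finite_imageD) (rule inj_on_subset[OF inj subset_UNIV])
  moreover have "g x ` (A \<inter> w ` A) = - (branch x \<union> branch y)"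
    unfolding image_Int[OF inj] gw g(2) by simp
  then have "infinite (A \<inter> w ` A)" using infinite_Compl_branches by (metis finite_imageI)
  ultimately show ?thesis using that[OF wW w] by blast
qed

text \<open>It suffices to multiply \<open>f\<close> from the left by permutations \<open>s\<close>, \<open>t\<close> and \<open>inv p\<close>, supported on
  \<open>A\<close>, \<open>B\<close> and \<open>A\<close>, so that the result fixes \<open>A - B\<close>, for then it is supported on \<open>B\<close>. A permutation
  supported on \<open>A\<close> can undo what happened to \<open>A - B\<close> as soon as its image lies in \<open>A\<close> and leaves
  infinitely many points of \<open>A\<close> free. The permutation \<open>t\<close> achieves this by moving the part of the
  image that lies in \<open>B\<close> into a sparse subset of \<open>A \<inter> B\<close>; for this the image must leave
  infinitely many points of \<open>B\<close> free, which is the purpose of \<open>s\<close>.\<close>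
lemma permutation_factorization:
  fixes A B :: "nat set"
  assumes inf: "infinite (A \<inter> B)" and f: "f permutes A \<union> B"
  obtains a b a' b' where "a permutes A" "b permutes B" "a' permutes A" "b' permutes B"
    "f = a \<circ> b \<circ> (a' \<circ> b')"
proof -
  obtain j :: "nat \<Rightarrow> nat" where j: "inj j" "range j \<subseteq> A \<inter> B" "infinite (range j)"
    "infinite (A \<inter> B - range j)"
    using infinite_nat_split[OF inf] by blast
  have "\<exists>s. s permutes A \<and> infinite (s ` f ` B \<inter> B)"
  proof (cases "finite (f ` B \<inter> B)")
    case False
    then show ?thesis using permutes_id by (intro exI[of _ id]) auto
  next
    case True
    have "infinite B" using inf by auto
    then have "infinite (f ` B)"
      using permutes_inj_on[OF f] finite_imageD by blast
    moreover have "f ` B \<subseteq> (f ` B \<inter> A) \<union> (f ` B \<inter> B)"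
      using permutes_in_image[OF f] by auto
    ultimately have "infinite (f ` B \<inter> A)" using True by (meson finite_UnI finite_subset)
    then obtain i :: "nat \<Rightarrow> nat" where i: "inj i" "range i \<subseteq> f ` B \<inter> A" "infinite (range i)"
      "infinite (f ` B \<inter> A - range i)"
      using infinite_nat_split by blast
    define e where "e x = j (inv i x)" for x
    have ei: "e (i k) = j k" for k using i(1) by (simp add: e_def)
    then have eran: "e ` range i = range j" by (auto simp: image_def)
    have "inj_on e (range i)" by (auto intro!: inj_onI simp: ei inj_eq[OF j(1)])
    moreover have "infinite (A - range i)" "infinite (A - range j)"
      using i(4) j(4) infinite_super[of "f ` B \<inter> A - range i" "A - range i"]
        infinite_super[of "A \<inter> B - range j" "A - range j"] by auto
    ultimately obtain s where s: "s permutes A" "\<And>x. x \<in> range i \<Longrightarrow> s x = e x"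
      using injection_extends_to_permutation[of "range i" A e] i(2) j(2) eran by auto
    have "range j \<subseteq> s ` f ` B \<inter> B"
    proof -
      have "s ` range i = range j" using s(2) eran by (auto simp: image_def)
      then show ?thesis using i(2) j(2) by blast
    qed
    then show ?thesis using s(1) j(3) finite_subset by blast
  qed
  then obtain s where s: "s permutes A" "infinite (s ` f ` B \<inter> B)" by blast
  \<comment> \<open>the set to be carried back to \<open>A - B\<close>\<close>
  define X where "X = s ` f ` (A - B)"
  have fs: "s \<circ> f permutes A \<union> B"
    using permutes_compose[OF f permutes_subset[OF s(1)]] by blast
  have sub: "s ` f ` B \<inter> B \<subseteq> B - X \<inter> B"
    using inj_eq[OF permutes_inj[OF fs]] by (auto simp: X_def)
  have XAB: "X \<subseteq> A \<union> B" using permutes_in_image[OF fs] by (auto simp: X_def)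
  obtain t where t: "t permutes B" "\<And>x. x \<in> X \<inter> B \<Longrightarrow> t x = j x"
  proof (rule injection_extends_to_permutation[of "X \<inter> B" B j])
    show "inj_on j (X \<inter> B)" using j(1) inj_on_subset by blast
    show "infinite (B - X \<inter> B)" using sub s(2) finite_subset by blast
    have "A \<inter> B - range j \<subseteq> B - j ` (X \<inter> B)" by auto
    then show "infinite (B - j ` (X \<inter> B))" using j(4) finite_subset by blast
  qed (use j(2) in auto)
  define e where "e = t \<circ> (s \<circ> f)"
  have einj: "inj e" unfolding e_def
    using permutes_inj[OF fs] permutes_inj[OF t(1)] by (rule inj_compose[rotated])
  have eX: "e ` (A - B) = t ` X" by (auto simp: e_def X_def)
  have tX: "t ` X \<subseteq> A"
  proof
    fix y assume "y \<in> t ` X"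
    then obtain x where x: "x \<in> X" "y = t x" by auto
    show "y \<in> A"
    proof (cases "x \<in> B")
      case True then show ?thesis using t(2) x j(2) by auto
    next
      case False then show ?thesis using permutes_not_in[OF t(1)] x XAB by auto
    qed
  qed
  have room: "A \<inter> B - range j \<subseteq> A - t ` X"
  proof
    fix y assume y: "y \<in> A \<inter> B - range j"
    have "y \<notin> t ` X"
    proof
      assume "y \<in> t ` X"
      then obtain x where x: "x \<in> X" "y = t x" by auto
      then have "x \<in> B" using y permutes_in_image[OF t(1)] by auto
      then show False using x t(2) y by auto
    qed
    then show "y \<in> A - t ` X" using y by auto
  qed
  obtain p where p: "p permutes A" "\<And>x. x \<in> A - B \<Longrightarrow> p x = e x"
  proof (rule injection_extends_to_permutation[of "A - B" A e])
    show "inj_on e (A - B)" using einj inj_on_subset by blast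
    show "infinite (A - (A - B))" using inf by (simp add: Diff_Diff_Int)
    show "infinite (A - e ` (A - B))" using room j(4) finite_subset eX by metis
  qed (use tX eX in auto)
  define q where "q = inv p \<circ> e"
  have pU: "p permutes A \<union> B" using p(1) permutes_subset by blast
  have "e permutes A \<union> B" unfolding e_def
    using permutes_compose[OF fs permutes_subset[OF t(1)]] by blast
  then have "q permutes A \<union> B" unfolding q_def
    using permutes_compose permutes_inv[OF pU] by blast
  moreover have "q x = x" if "x \<in> A \<union> B - B" for x
    using p(2)[of x] that permutes_inverses(2)[OF p(1), of x] by (auto simp: q_def)
  ultimately have q: "q permutes B" using permutes_superset by blast
  have "inv s \<circ> inv t \<circ> (p \<circ> q) = f"
    using permutes_inv_o[OF p(1)] permutes_inv_o[OF s(1)] permutes_inv_o[OF t(1)]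
    by (simp add: q_def e_def fun_eq_iff)
  then show ?thesis using that[of "inv s" "inv t" p q] s t p q permutes_inv by metis
qed

text \<open>Greedy choice: a chosen point \<open>x\<close> excludes only itself, \<open>v x\<close> and the preimage of \<open>x\<close>.\<close>
lemma independent_subset:
  fixes v :: "'a \<Rightarrow> 'a"
  assumes "inj v" "finite D" "\<And>x. x \<in> D \<Longrightarrow> v x \<noteq> x" "3 * n \<le> card D"
  obtains I where "I \<subseteq> D" "card I = n" "v ` I \<inter> I = {}"
proof -
  have "\<exists>I\<subseteq>D. card I = n \<and> v ` I \<inter> I = {}"
    using assms(2-4)
  proof (induction n arbitrary: D)
    case 0
    show ?case by (intro exI[of _ "{}"]) simp
  next
    case (Suc n)
    have "D \<noteq> {}" using Suc.prems(3) by auto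
    then obtain x where x: "x \<in> D" by auto
    define D' where "D' = D - {x, v x, inv v x}"
    have "card {x, v x, inv v x} \<le> 3" by (simp add: card_insert_if)
    then have "card D \<le> card D' + 3"
      unfolding D'_def using card_Diff_subset_Int[of D "{x, v x, inv v x}"]
        diff_card_le_card_Diff[of "{x, v x, inv v x}" D] by simp
    then have "3 * n \<le> card D'" using Suc.prems(3) by simp
    then obtain I where I: "I \<subseteq> D'" "card I = n" "v ` I \<inter> I = {}"
      using Suc.IH[of D'] Suc.prems(1,2) unfolding D'_def by blast
    have "finite I" using I(1) Suc.prems(1) finite_subset by (auto simp: D'_def)
    moreover have "x \<notin> I" "v x \<notin> I" using I(1) by (auto simp: D'_def)
    moreover have "v y \<noteq> x" if "y \<in> I" for y
      using that I(1) assms(1) by (auto simp: D'_def)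
    ultimately show ?case using I x Suc.prems(2)[OF x]
      by (intro exI[of _ "insert x I"]) (auto simp: D'_def)
  qed
  then show ?thesis using that by blast
qed

section \<open>Neighbourhoods of the identity in a group topology\<close>

lemma carrier_S_infinity: "carrier S_infinity = {f. bij f}"
  by (simp add: BijGroup_def Bij_def extensional_def)

lemma mult_S_infinity: "bij f \<Longrightarrow> bij g \<Longrightarrow> f \<otimes>\<^bsub>S_infinity\<^esub> g = f \<circ> g"
  by (simp add: BijGroup_def Bij_def extensional_def compose_def fun_eq_iff)

lemma m_inv_S_infinity: "bij f \<Longrightarrow> m_inv S_infinity f = inv f"
proof -
  assume f: "bij f"
  interpret group S_infinity by (rule group_BijGroup)
  show ?thesis
  proof (rule inv_equality)
    have "\<one>\<^bsub>S_infinity\<^esub> = id" by (simp add: BijGroup_def fun_eq_iff)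
    then show "inv f \<otimes>\<^bsub>S_infinity\<^esub> f = \<one>\<^bsub>S_infinity\<^esub>"
      using f by (simp add: mult_S_infinity bij_imp_bij_inv bij_is_inj)
  qed (use f in \<open>auto simp: carrier_S_infinity bij_imp_bij_inv\<close>)
qed

lemma group_topology_S_infinity_iff:
  "group_topology S_infinity T \<longleftrightarrow> topspace T = {f. bij f} \<and>
     continuous_map (prod_topology T T) T (\<lambda>(f, g). f \<circ> g) \<and> continuous_map T T inv"
proof (cases "topspace T = {f. bij f}")
  case True
  have "continuous_map (prod_topology T T) T (\<lambda>(f, g). f \<otimes>\<^bsub>S_infinity\<^esub> g)
      \<longleftrightarrow> continuous_map (prod_topology T T) T (\<lambda>(f, g). f \<circ> g)"
    by (rule iffI; erule continuous_map_eq) (auto simp: True mult_S_infinity)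
  moreover have "continuous_map T T (m_inv S_infinity) \<longleftrightarrow> continuous_map T T inv"
    by (rule iffI; erule continuous_map_eq) (auto simp: True m_inv_S_infinity)
  ultimately show ?thesis using True by (simp add: group_topology_def carrier_S_infinity)
qed (simp add: group_topology_def carrier_S_infinity)

locale permutation_group_topology =
  fixes T :: "(nat \<Rightarrow> nat) topology"
  assumes group_topology: "group_topology S_infinity T"
begin

definition nbhd :: "(nat \<Rightarrow> nat) set \<Rightarrow> bool" where
  "nbhd U \<longleftrightarrow> openin T U \<and> id \<in> U"

lemma topspace: "topspace T = {f. bij f}"
  using group_topology by (simp add: group_topology_S_infinity_iff)

lemma nbhd_bij: "nbhd U \<Longrightarrow> u \<in> U \<Longrightarrow> bij u"
  using openin_subset[of T U] topspace by (auto simp: nbhd_def)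

lemma continuous_mult: "continuous_map (prod_topology T T) T (\<lambda>(f, g). f \<circ> g)"
  using group_topology by (simp add: group_topology_S_infinity_iff)

lemma continuous_inv: "continuous_map T T inv"
  using group_topology by (simp add: group_topology_S_infinity_iff)

lemma continuous_comp:
  assumes "continuous_map X T f" "continuous_map X T g"
  shows "continuous_map X T (\<lambda>x. f x \<circ> g x)"
proof -
  have "continuous_map X (prod_topology T T) (\<lambda>x. (f x, g x))"
    using assms by (simp add: continuous_map_pairedI)
  from continuous_map_compose[OF this continuous_mult] show ?thesis by (simp add: o_def)
qed

lemma openin_left_translate:
  assumes "openin T U" "bij g"
  shows "openin T {h. bij h \<and> g \<circ> h \<in> U}"
proof -
  have "continuous_map T T (\<lambda>h. g \<circ> h)"
    using assms(2) by (intro continuous_comp) (auto simp: topspace)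
  from openin_continuous_map_preimage[OF this assms(1)] show ?thesis by (simp add: topspace)
qed

lemma nbhd_conjugate:
  assumes "nbhd U" "bij g"
  shows "nbhd {h. bij h \<and> inv g \<circ> h \<circ> g \<in> U}"
proof -
  have "continuous_map T T (\<lambda>h. inv g \<circ> h \<circ> g)"
    using assms(2) by (intro continuous_comp) (auto simp: topspace bij_imp_bij_inv)
  from openin_continuous_map_preimage[OF this] assms show ?thesis
    by (simp add: topspace nbhd_def bij_is_inj)
qed

lemma nbhd_square:
  assumes "nbhd U"
  obtains V where "nbhd V" "\<forall>x\<in>V. inv x \<in> V" "\<forall>x\<in>V. \<forall>y\<in>V. x \<circ> y \<in> U"
proof -
  define P where "P = {p \<in> topspace (prod_topology T T). (case p of (x, y) \<Rightarrow> x \<circ> y) \<in> U}"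
  have opP: "openin (prod_topology T T) P"
    unfolding P_def using assms
    by (intro openin_continuous_map_preimage[OF continuous_mult]) (simp add: nbhd_def)
  have idP: "(id, id) \<in> P"
    using assms by (simp add: P_def nbhd_def topspace)
  obtain A B where AB: "openin T A" "openin T B" "id \<in> A" "id \<in> B" and sub: "A \<times> B \<subseteq> P"
    using opP[unfolded openin_prod_topology_alt, THEN spec, THEN spec, THEN mp, OF idP] by blast
  have prod: "x \<circ> y \<in> U" if "x \<in> A" "y \<in> B" for x y
    using subsetD[OF sub, of "(x, y)"] that by (simp add: P_def)
  define V where "V = (A \<inter> B) \<inter> {x. bij x \<and> inv x \<in> A \<inter> B}"
  have "openin T {x \<in> topspace T. inv x \<in> A \<inter> B}"
    by (rule openin_continuous_map_preimage[OF continuous_inv openin_Int[OF AB(1,2)]])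
  then have "nbhd V" using AB by (simp add: nbhd_def V_def topspace openin_Int)
  moreover have "\<forall>x\<in>V. inv x \<in> V"
    by (simp add: V_def inv_inv_eq bij_imp_bij_inv)
  moreover have "\<forall>x\<in>V. \<forall>y\<in>V. x \<circ> y \<in> U"
    using prod by (simp add: V_def)
  ultimately show ?thesis by (rule that)
qed

lemma nbhd_fourth_power:
  assumes "nbhd U"
  obtains V where "nbhd V" "\<forall>x\<in>V. inv x \<in> V" "V \<subseteq> U"
    "\<forall>a\<in>V. \<forall>b\<in>V. \<forall>c\<in>V. \<forall>d\<in>V. a \<circ> b \<circ> (c \<circ> d) \<in> U"
proof -
  obtain W where W: "nbhd W" "\<forall>x\<in>W. inv x \<in> W" "\<forall>x\<in>W. \<forall>y\<in>W. x \<circ> y \<in> U"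
    by (rule nbhd_square[OF assms])
  obtain V where V: "nbhd V" "\<forall>x\<in>V. inv x \<in> V"
    "\<forall>x\<in>V. \<forall>y\<in>V. x \<circ> y \<in> W"
    by (rule nbhd_square[OF W(1)])
  have four: "a \<circ> b \<circ> (c \<circ> d) \<in> U" if "a \<in> V" "b \<in> V" "c \<in> V" "d \<in> V" for a b c d
    using that V(3) W(3) by blast
  have "V \<subseteq> U" using four[of _ id id id] V(1) by (auto simp: nbhd_def)
  then show ?thesis using that[OF V(1,2)] four by blast
qed

lemma nbhd_finite_choice:
  assumes "finite I" "\<And>i. i \<in> I \<Longrightarrow> \<exists>V. nbhd V \<and> (\<forall>v\<in>V. P i v)"
  shows "\<exists>V. nbhd V \<and> (\<forall>v\<in>V. \<forall>i\<in>I. P i v)"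
proof -
  obtain V where V: "\<And>i. i \<in> I \<Longrightarrow> nbhd (V i)" "\<And>i v. i \<in> I \<Longrightarrow> v \<in> V i \<Longrightarrow> P i v"
    using assms(2) by metis
  have "openin T ((\<Inter>i\<in>I. V i) \<inter> topspace T)"
    using assms(1) V(1) by (intro openin_INT) (auto simp: nbhd_def)
  then have "nbhd ((\<Inter>i\<in>I. V i) \<inter> topspace T)" using V(1) by (auto simp: nbhd_def topspace)
  then show ?thesis using V(2) by blast
qed

section \<open>Separable group topologies are coarser than pointwise convergence\<close>

text \<open>Colour \<open>g\<close> by an element of the dense set that is close to it.\<close>
lemma separable_colouring:
  assumes "separable_space T" "nbhd W"
  obtains c :: "(nat \<Rightarrow> nat) \<Rightarrow> nat" where "\<forall>g h. bij g \<longrightarrow> bij h \<longrightarrow> c g = c h \<longrightarrow> inv g \<circ> h \<in> W"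
proof -
  obtain V where V: "nbhd V" "\<forall>x\<in>V. inv x \<in> V"
    "\<forall>x\<in>V. \<forall>y\<in>V. x \<circ> y \<in> W"
    by (rule nbhd_square[OF assms(2)])
  obtain C where C: "countable C" "C \<subseteq> topspace T" "T closure_of C = topspace T"
    using assms(1) by (auto simp: separable_space_def)
  have "\<exists>k\<in>C. inv g \<circ> k \<in> V" if g: "bij g" for g
  proof -
    define N where "N = {k. bij k \<and> inv g \<circ> k \<in> V}"
    have "openin T N"
      unfolding N_def using V(1) g by (intro openin_left_translate) (auto simp: nbhd_def bij_imp_bij_inv)
    moreover have "g \<in> N"
      using V(1) g by (simp add: N_def nbhd_def bij_is_inj)
    moreover have "g \<in> T closure_of C" using C(3) g by (simp add: topspace)
    ultimately have "\<exists>k. k \<in> C \<and> k \<in> N" unfolding in_closure_of by blast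
    then show ?thesis by (auto simp: N_def)
  qed
  then obtain k where k: "\<And>g. bij g \<Longrightarrow> k g \<in> C" "\<And>g. bij g \<Longrightarrow> inv g \<circ> k g \<in> V" by metis
  show ?thesis
  proof (rule that[of "\<lambda>g. to_nat_on C (k g)"], intro allI impI)
    fix g h :: "nat \<Rightarrow> nat"
    assume gh: "bij g" "bij h" and "to_nat_on C (k g) = to_nat_on C (k h)"
    then have eq: "k h = k g" using inj_onD[OF inj_on_to_nat_on[OF C(1)]] k(1) by metis
    have bk: "bij (k g)" using k(1) gh(1) C(2) by (auto simp: topspace)
    have "inv g \<circ> h = (inv g \<circ> k g) \<circ> inv (inv h \<circ> k g)"
    proof -
      have "inv (inv h \<circ> k g) = inv (k g) \<circ> h"
        using gh(2) bk by (simp add: o_inv_distrib bij_imp_bij_inv inv_inv_eq)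
      then show ?thesis
        using bij_is_surj[OF bk] by (simp add: fun_eq_iff surj_f_inv_f)
    qed
    moreover have "inv (inv h \<circ> k g) \<in> V" using k(2)[OF gh(2)] eq V(2) by simp
    ultimately show "inv g \<circ> h \<in> W" using k(2)[OF gh(1)] V(3) by simp
  qed
qed

lemma conjugate_cancel:
  assumes "bij v"
  shows "v \<circ> (inv v \<circ> d \<circ> v) \<circ> (inv v \<circ> id) = d"
  using bij_is_surj[OF assms] by (simp add: fun_eq_iff surj_f_inv_f)

text \<open>Permutations supported on the moiety \<open>A\<close> are products of four elements of \<open>V3\<close> and hence lie in \<open>V2\<close>.
  Those supported on its translate \<open>w ` A\<close> are conjugate to them by \<open>w \<in> V3\<close> and lie in \<open>V1\<close>. Four
  factors from \<open>V1\<close> give \<open>U\<close>, and they produce every permutation that fixes the finite set which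
  \<open>A\<close> and \<open>w ` A\<close> leave uncovered.\<close>
lemma nbhd_contains_stabilizer:
  assumes "separable_space T" "nbhd U"
  obtains F where "finite F" "\<forall>f. bij f \<longrightarrow> (\<forall>x\<in>F. f x = x) \<longrightarrow> f \<in> U"
proof -
  obtain V1 where V1: "nbhd V1" "\<forall>x\<in>V1. inv x \<in> V1" "V1 \<subseteq> U"
    "\<forall>a\<in>V1. \<forall>b\<in>V1. \<forall>c\<in>V1. \<forall>d\<in>V1. a \<circ> b \<circ> (c \<circ> d) \<in> U"
    by (rule nbhd_fourth_power[OF assms(2)])
  obtain V2 where V2: "nbhd V2" "\<forall>x\<in>V2. inv x \<in> V2" "V2 \<subseteq> V1"
    "\<forall>a\<in>V2. \<forall>b\<in>V2. \<forall>c\<in>V2. \<forall>d\<in>V2. a \<circ> b \<circ> (c \<circ> d) \<in> V1"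
    by (rule nbhd_fourth_power[OF V1(1)])
  obtain V3 where V3: "nbhd V3" "\<forall>x\<in>V3. inv x \<in> V3" "V3 \<subseteq> V2"
    "\<forall>a\<in>V3. \<forall>b\<in>V3. \<forall>c\<in>V3. \<forall>d\<in>V3. a \<circ> b \<circ> (c \<circ> d) \<in> V2"
    by (rule nbhd_fourth_power[OF V2(1)])
  obtain c :: "(nat \<Rightarrow> nat) \<Rightarrow> nat"
    where "\<forall>g h. bij g \<longrightarrow> bij h \<longrightarrow> c g = c h \<longrightarrow> inv g \<circ> h \<in> V3"
    by (rule separable_colouring[OF assms(1) V3(1)])
  then have c: "\<And>g h. bij g \<Longrightarrow> bij h \<Longrightarrow> c g = c h \<Longrightarrow> inv g \<circ> h \<in> V3" by blast
  obtain A where A: "infinite A" "infinite (- A)" and com: "\<forall>d. d permutes A \<longrightarrow>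
      (\<exists>a\<in>V3. \<exists>b\<in>V3. bij a \<and> bij b \<and> d = b \<circ> a \<circ> (inv b \<circ> inv a))"
    using moiety_of_commutators[of c V3, OF c] by blast
  have symA: "d \<in> V2" if "d permutes A" for d
  proof -
    obtain a b where ab: "a \<in> V3" "b \<in> V3" "d = b \<circ> a \<circ> (inv b \<circ> inv a)"
      using com \<open>d permutes A\<close> by blast
    then show ?thesis using V3(2,4) by simp
  qed
  obtain w where w: "w \<in> V3" "bij w" "finite (- (A \<union> w ` A))" "infinite (A \<inter> w ` A)"
    by (rule moiety_translate_almost_covers[of c V3 A, OF c A])
  have symwA: "d \<in> V1" if d: "d permutes w ` A" for d
  proof -
    have "inv w \<circ> d \<circ> w permutes A"
    proof -
      have "inv w \<circ> d \<circ> w permutes UNIV"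
        by (intro bij_imp_permutes bij_comp bij_imp_bij_inv w(2) permutes_bij[OF d]) simp
      moreover have "(inv w \<circ> d \<circ> w) x = x" if "x \<in> UNIV - A" for x
        using that permutes_not_in[OF d, of "w x"] bij_is_inj[OF w(2)]
        by (auto simp: inj_image_mem_iff)
      ultimately show ?thesis by (rule permutes_superset)
    qed
    then have "inv w \<circ> d \<circ> w \<in> V2" by (rule symA)
    moreover have "w \<in> V2" "inv w \<in> V2" "id \<in> V2"
      using w(1) V2 V3(3) by (auto simp: nbhd_def)
    ultimately show ?thesis
      using V2(4)[THEN bspec, THEN bspec, THEN bspec, THEN bspec, of w "inv w \<circ> d \<circ> w" "inv w" id]
        conjugate_cancel[OF w(2), of d] by simp
  qed
  show ?thesis
  proof (rule that[OF w(3)], intro allI impI)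
    fix f :: "nat \<Rightarrow> nat" assume f: "bij f" "\<forall>x\<in>- (A \<union> w ` A). f x = x"
    have "f permutes UNIV" using f(1) by (rule bij_imp_permutes) simp
    then have "f permutes A \<union> w ` A" by (rule permutes_superset) (use f(2) in blast)
    from permutation_factorization[OF w(4) this]
    obtain a b a' b' where "a permutes A" "b permutes w ` A" "a' permutes A" "b' permutes w ` A" "f = a \<circ> b \<circ> (a' \<circ> b')"
      by blast
    moreover then have "a \<in> V1" "b \<in> V1" "a' \<in> V1" "b' \<in> V1" using symA symwA V2(3) by auto
    ultimately show "f \<in> U" using V1(4) by simp
  qed
qed

section \<open>Non-trivial separable group topologies are finer than pointwise convergence\<close>

text \<open>If \<open>v ` F\<close> misses \<open>F\<close>, the complements of \<open>F\<close> and \<open>v ` F\<close> cover everything and have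
  infinite intersection, so every permutation factors into four permutations each of which fixes
  \<open>F\<close> or \<open>v ` F\<close> pointwise. If \<open>V\<close> contains the stabilizer of \<open>F\<close>, and \<open>v\<close> as well, then a power
  of \<open>V\<close> is the whole group. Non-triviality provides a \<open>U\<close> that contains no such power.\<close>
lemma nbhd_moves_finite_set_little:
  assumes sep: "separable_space T" and nontriv: "\<not> indiscrete_space T"
  obtains V F where "nbhd V" "finite F" "\<forall>v\<in>V. v ` F \<inter> F \<noteq> {}"
proof -
  have "{{}, topspace T} \<subseteq> {U. openin T U}" by auto
  then obtain S where S: "openin T S" "S \<noteq> {}" "S \<noteq> topspace T"
    using nontriv unfolding indiscrete_space_def by blast
  then obtain g k where "g \<in> S" and k: "k \<notin> S" "k \<in> topspace T"
    using openin_subset[OF S(1)] by blast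
  then have g: "g \<in> S" "bij g" and bk: "bij k" using openin_subset[OF S(1)] topspace by auto
  define U where "U = {h. bij h \<and> g \<circ> h \<in> S}"
  have U: "nbhd U" using openin_left_translate[OF S(1) g(2)] g by (simp add: nbhd_def U_def)
  have notU: "inv g \<circ> k \<notin> U"
    using k(1) bij_is_surj[OF g(2)] by (simp add: U_def o_assoc surj_iff)
  obtain V1 where V1: "nbhd V1" "\<forall>x\<in>V1. inv x \<in> V1" "V1 \<subseteq> U"
    "\<forall>a\<in>V1. \<forall>b\<in>V1. \<forall>c\<in>V1. \<forall>d\<in>V1. a \<circ> b \<circ> (c \<circ> d) \<in> U"
    by (rule nbhd_fourth_power[OF U])
  obtain V where V: "nbhd V" "\<forall>x\<in>V. inv x \<in> V" "V \<subseteq> V1"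
    "\<forall>a\<in>V. \<forall>b\<in>V. \<forall>c\<in>V. \<forall>d\<in>V. a \<circ> b \<circ> (c \<circ> d) \<in> V1"
    by (rule nbhd_fourth_power[OF V1(1)])
  obtain F where F: "finite F" "\<forall>f. bij f \<longrightarrow> (\<forall>x\<in>F. f x = x) \<longrightarrow> f \<in> V"
    by (rule nbhd_contains_stabilizer[OF sep V(1)])
  have "v ` F \<inter> F \<noteq> {}" if v: "v \<in> V" for v
  proof
    assume disj: "v ` F \<inter> F = {}"
    have bv: "bij v" using nbhd_bij V(1) v by blast
    have A: "d \<in> V" if "d permutes - F" for d
      using F(2) permutes_bij[OF that] permutes_not_in[OF that] by auto
    have B: "d \<in> V1" if d: "d permutes - v ` F" for d
    proof -
      have "inv v \<circ> d \<circ> v \<in> V"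
      proof (intro F(2)[rule_format])
        show "bij (inv v \<circ> d \<circ> v)" by (intro bij_comp bij_imp_bij_inv bv permutes_bij[OF d])
        show "(inv v \<circ> d \<circ> v) x = x" if "x \<in> F" for x
          using permutes_not_in[OF d, of "v x"] that bij_is_inj[OF bv] by simp
      qed
      then show ?thesis
        using V(4)[THEN bspec, THEN bspec, THEN bspec, THEN bspec, of v "inv v \<circ> d \<circ> v" "inv v" id]
          V(1,2) v conjugate_cancel[OF bv, of d] by (simp add: nbhd_def)
    qed
    have "finite (F \<union> v ` F)" using F(1) by simp
    then have "infinite (- (F \<union> v ` F))" using finite_compl infinite_UNIV_nat by metis
    then have "infinite (- F \<inter> - v ` F)" by (simp only: Compl_Un not_False_eq_True)
    moreover have "inv g \<circ> k permutes - F \<union> - v ` F"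
    proof -
      have "- F \<union> - v ` F = UNIV" using disj by auto
      moreover have "bij (inv g \<circ> k)" by (intro bij_comp bij_imp_bij_inv g bk)
      ultimately show ?thesis using bij_imp_permutes[of _ UNIV] by simp
    qed
    ultimately obtain a b a' b' where "a permutes - F" "b permutes - v ` F" "a' permutes - F"
      "b' permutes - v ` F" "inv g \<circ> k = a \<circ> b \<circ> (a' \<circ> b')"
      using permutation_factorization by blast
    moreover then have "a \<in> V1" "b \<in> V1" "a' \<in> V1" "b' \<in> V1" using A B V(3) by auto
    ultimately have "inv g \<circ> k \<in> U" using V1(4) by simp
    then show False using notU by blast
  qed
  then show ?thesis using that V(1) F(1) by blast
qed

text \<open>By conjugation the hypothesis on \<open>F\<close> transfers to every set of the same size, with another
  neighbourhood, and \<open>E\<close> has only finitely many subsets of that size. A permutation that moves more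
  than \<open>3 * card F\<close> points of \<open>E\<close> moves some subset of size \<open>card F\<close> off itself.\<close>
lemma nbhd_moves_boundedly_many:
  assumes "nbhd V" "finite F" "\<forall>v\<in>V. v ` F \<inter> F \<noteq> {}" "finite E"
  shows "\<exists>V'. nbhd V' \<and> (\<forall>v\<in>V'. card {x \<in> E. v x \<noteq> x} \<le> 3 * card F)"
proof -
  have "\<exists>V'. nbhd V' \<and> (\<forall>v\<in>V'. v ` I \<inter> I \<noteq> {})" if "I \<in> {I. I \<subseteq> E \<and> card I = card F}" for I
  proof -
    have "finite I" "card F = card I" using that assms(4) finite_subset by auto
    then obtain e where e: "bij_betw e F I"
      using finite_same_card_bij[OF assms(2)] by blast
    then obtain g where g: "g permutes UNIV" "\<And>x. x \<in> F \<Longrightarrow> g x = e x"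
      using injection_extends_to_permutation[of F UNIV e] assms(2) \<open>finite I\<close>
      by (auto simp: bij_betw_def Compl_eq_Diff_UNIV[symmetric])
    have bg: "bij g" using permutes_bij[OF g(1)] .
    have gF: "g ` F = I" using g(2) e by (auto simp: bij_betw_def image_def)
    have "v ` I \<inter> I \<noteq> {}" if v: "inv g \<circ> v \<circ> g \<in> V" for v
    proof -
      obtain x y where "x \<in> F" "y \<in> F" "inv g (v (g x)) = y" using assms(3)[rule_format, OF v] by auto
      then have "v (g x) = g y" using bij_is_surj[OF bg] surj_f_inv_f by metis
      then show ?thesis using \<open>x \<in> F\<close> \<open>y \<in> F\<close> gF by blast
    qed
    then show ?thesis using nbhd_conjugate[OF assms(1) bg] by blast
  qed
  moreover have "finite {I. I \<subseteq> E \<and> card I = card F}" using assms(4) by simp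
  ultimately obtain V' where V': "nbhd V'"
    "\<And>v I. v \<in> V' \<Longrightarrow> I \<subseteq> E \<Longrightarrow> card I = card F \<Longrightarrow> v ` I \<inter> I \<noteq> {}"
    using nbhd_finite_choice[of "{I. I \<subseteq> E \<and> card I = card F}" "\<lambda>I v. v ` I \<inter> I \<noteq> {}"] by auto
  have "card {x \<in> E. v x \<noteq> x} \<le> 3 * card F" if v: "v \<in> V'" for v
  proof (rule ccontr)
    assume "\<not> ?thesis"
    then have le: "3 * card F \<le> card {x \<in> E. v x \<noteq> x}" by simp
    have inj: "inj v" using bij_is_inj[OF nbhd_bij[OF V'(1) v]] .
    have fin: "finite {x \<in> E. v x \<noteq> x}" using assms(4) by simp
    have "v x \<noteq> x" if "x \<in> {x \<in> E. v x \<noteq> x}" for x using that by simp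
    from independent_subset[OF inj fin this le]
    obtain I where "I \<subseteq> {x \<in> E. v x \<noteq> x}" "card I = card F" "v ` I \<inter> I = {}" by blast
    then show False using V'(2)[OF v, of I] by auto
  qed
  then show ?thesis using V'(1) by blast
qed

text \<open>Let \<open>m\<close> be the least bound on the number of points that small permutations move in a finite
  set, and suppose \<open>m > 0\<close>. By minimality some \<open>E\<close> has arbitrarily small permutations \<open>v\<close> that
  move at least \<open>m\<close> of its points, and by conjugation so does a disjoint copy \<open>E'\<close>, via permutations \<open>w\<close>.
  The bound for \<open>E \<union> E'\<close> forces \<open>v\<close> to fix \<open>E'\<close> and \<open>w\<close> to fix \<open>E\<close>, whence \<open>w \<circ> v\<close> moves
  at least \<open>2 * m\<close> points.\<close>
lemma nbhd_fixes_finite_set: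
  assumes sep: "separable_space T" and nontriv: "\<not> indiscrete_space T" and "finite F"
  obtains V where "nbhd V" "\<forall>v\<in>V. \<forall>x\<in>F. v x = x"
proof -
  define bound where "bound m \<longleftrightarrow> (\<forall>E. finite E \<longrightarrow>
      (\<exists>V. nbhd V \<and> (\<forall>v\<in>V. card {x \<in> E. v x \<noteq> x} \<le> m)))" for m
  obtain V F' where "nbhd V" "finite F'" "\<forall>v\<in>V. v ` F' \<inter> F' \<noteq> {}"
    by (rule nbhd_moves_finite_set_little[OF sep nontriv])
  then have "bound (3 * card F')" unfolding bound_def using nbhd_moves_boundedly_many by simp
  then have ex: "\<exists>m. bound m" by blast
  define m where "m = (LEAST m. bound m)"
  have bm: "bound m" unfolding m_def using ex by (rule LeastI_ex)
  have "m = 0"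
  proof (rule ccontr)
    assume "m \<noteq> 0"
    then have "\<not> bound (m - 1)" unfolding m_def by (intro not_less_Least) simp
    then obtain E where E: "finite E"
      "\<And>V. nbhd V \<Longrightarrow> \<exists>v\<in>V. \<not> card {x \<in> E. v x \<noteq> x} \<le> m - 1"
      unfolding bound_def by blast
    obtain N where N: "\<And>x. x \<in> E \<Longrightarrow> x < N" using E(1) by (metis finite_nat_set_iff_bounded)
    define E' where "E' = (\<lambda>x. x + N) ` E"
    have fE': "finite E'" using E(1) by (simp add: E'_def)
    have disj: "E \<inter> E' = {}" using N by (fastforce simp: E'_def)
    obtain g where g: "g permutes UNIV" "\<And>x. x \<in> E \<Longrightarrow> g x = x + N"
      using injection_extends_to_permutation[of E UNIV "\<lambda>x. x + N"] E(1) fE'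
      by (auto simp: E'_def Compl_eq_Diff_UNIV[symmetric])
    have bg: "bij g" using permutes_bij[OF g(1)] .
    obtain V0 where V0: "nbhd V0" "\<And>v. v \<in> V0 \<Longrightarrow> card {x \<in> E \<union> E'. v x \<noteq> x} \<le> m"
      using bm E(1) fE' unfolding bound_def by (metis finite_UnI)
    obtain V where V: "nbhd V" "\<forall>x\<in>V. inv x \<in> V" "\<forall>x\<in>V. \<forall>y\<in>V. x \<circ> y \<in> V0"
      by (rule nbhd_square[OF V0(1)])
    have VV0: "v \<in> V0" if "v \<in> V" for v
    proof -
      have "v \<circ> id \<in> V0" using V(1,3) that unfolding nbhd_def by blast
      then show ?thesis by simp
    qed
    obtain v where v: "v \<in> V" "m \<le> card {x \<in> E. v x \<noteq> x}" using E(2)[OF V(1)] by fastforce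
    have "bij (inv g)" using bg bij_imp_bij_inv by blast
    from nbhd_conjugate[OF V(1) this] E(2)
    obtain u where u: "bij u" "g \<circ> u \<circ> inv g \<in> V" "m \<le> card {x \<in> E. u x \<noteq> x}"
      using bg by (fastforce simp: inv_inv_eq)
    define w where "w = g \<circ> u \<circ> inv g"
    have wg: "w (g x) = g (u x)" for x using bij_is_inj[OF bg] by (simp add: w_def)
    have moved: "{x \<in> E'. w x \<noteq> x} = g ` {x \<in> E. u x \<noteq> x}"
    proof -
      have "E' = g ` E" using g(2) by (auto simp: E'_def image_def)
      then show ?thesis using wg bij_is_inj[OF bg] by (auto simp: inj_eq)
    qed
    then have cw: "m \<le> card {x \<in> E'. w x \<noteq> x}"
      using u(3) card_image[OF inj_on_subset[OF bij_is_inj[OF bg] subset_UNIV]] by simp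
    have split: "card {x \<in> E \<union> E'. p x \<noteq> x} = card {x \<in> E. p x \<noteq> x} + card {x \<in> E'. p x \<noteq> x}" for p
    proof -
      have "{x \<in> E \<union> E'. p x \<noteq> x} = {x \<in> E. p x \<noteq> x} \<union> {x \<in> E'. p x \<noteq> x}" by auto
      then show ?thesis using disj E(1) fE' by (auto intro!: card_Un_disjoint)
    qed
    have "card {x \<in> E'. v x \<noteq> x} = 0"
      using V0(2)[OF VV0[OF v(1)]] v(2) split[of v] by simp
    then have vfix: "v x = x" if "x \<in> E'" for x using fE' that by simp
    have wV: "w \<in> V" using u(2) w_def by simp
    have "card {x \<in> E. w x \<noteq> x} = 0"
      using V0(2)[OF VV0[OF wV]] cw split[of w] by simp
    then have wfix: "w x = x" if "x \<in> E" for x using E(1) that by simp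
    have iw: "inj w" using nbhd_bij[OF V(1) wV] bij_is_inj by blast
    have "{x \<in> E. (w \<circ> v) x \<noteq> x} = {x \<in> E. v x \<noteq> x}"
    proof -
      have "(w \<circ> v) x = x \<longleftrightarrow> v x = x" if "x \<in> E" for x
        using inj_eq[OF iw, of "v x" x] wfix[OF that] by simp
      then show ?thesis by blast
    qed
    moreover have "{x \<in> E'. (w \<circ> v) x \<noteq> x} = {x \<in> E'. w x \<noteq> x}"
      using vfix by auto
    ultimately have "m + m \<le> card {x \<in> E \<union> E'. (w \<circ> v) x \<noteq> x}"
      using split[of "w \<circ> v"] v(2) cw by simp
    then show False using V0(2)[of "w \<circ> v"] V(3) wV v(1) \<open>m \<noteq> 0\<close> by fastforce
  qed
  with bm have "bound 0" by simp
  then obtain V where V: "nbhd V" "\<forall>v\<in>V. card {x \<in> F. v x \<noteq> x} \<le> 0"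
    using assms(3) unfolding bound_def by blast
  have "\<forall>v\<in>V. \<forall>x\<in>F. v x = x" using V(2) assms(3) by auto
  then show ?thesis using that V(1) by blast
qed

end

section \<open>The topology of pointwise convergence\<close>

definition pointwise_open :: "(nat \<Rightarrow> nat) set \<Rightarrow> bool" where
  "pointwise_open S \<longleftrightarrow> (\<forall>g\<in>S. bij g \<and>
     (\<exists>F. finite F \<and> (\<forall>h. bij h \<and> (\<forall>x\<in>F. h x = g x) \<longrightarrow> h \<in> S)))"

lemma pointwise_openE:
  assumes "pointwise_open S" "g \<in> S"
  obtains F where "finite F" "\<And>h. bij h \<Longrightarrow> (\<And>x. x \<in> F \<Longrightarrow> h x = g x) \<Longrightarrow> h \<in> S"
  using assms unfolding pointwise_open_def by metis

definition pointwise_topology :: "(nat \<Rightarrow> nat) topology" where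
  "pointwise_topology = topology pointwise_open"

lemma openin_pointwise_topology: "openin pointwise_topology = pointwise_open"
proof -
  have "istopology pointwise_open"
    unfolding istopology_def
  proof (intro conjI allI impI)
    fix S S' assume "pointwise_open S" "pointwise_open S'"
    show "pointwise_open (S \<inter> S')"
      unfolding pointwise_open_def
    proof (intro ballI conjI)
      fix g assume g: "g \<in> S \<inter> S'"
      show "bij g" using g \<open>pointwise_open S\<close> by (auto simp: pointwise_open_def)
      obtain F where F: "finite F" "\<And>h. bij h \<Longrightarrow> (\<And>x. x \<in> F \<Longrightarrow> h x = g x) \<Longrightarrow> h \<in> S"
        using pointwise_openE \<open>pointwise_open S\<close> g by blast
      obtain F' where F': "finite F'" "\<And>h. bij h \<Longrightarrow> (\<And>x. x \<in> F' \<Longrightarrow> h x = g x) \<Longrightarrow> h \<in> S'"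
        using pointwise_openE \<open>pointwise_open S'\<close> g by blast
      show "\<exists>F. finite F \<and> (\<forall>h. bij h \<and> (\<forall>x\<in>F. h x = g x) \<longrightarrow> h \<in> S \<inter> S')"
        using F F' by (intro exI[of _ "F \<union> F'"]) auto
    qed
  next
    fix K assume "\<forall>S\<in>K. pointwise_open S"
    then show "pointwise_open (\<Union>K)" unfolding pointwise_open_def by (meson UnionE UnionI)
  qed
  then show ?thesis by (simp add: pointwise_topology_def topology_inverse')
qed

lemma topspace_pointwise_topology: "topspace pointwise_topology = {f. bij f}"
proof -
  have "openin pointwise_topology {f. bij f}"
    by (auto simp: openin_pointwise_topology pointwise_open_def)
  then have "{f. bij f} \<subseteq> topspace pointwise_topology" by (rule openin_subset)
  moreover have "pointwise_open (topspace pointwise_topology)"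
    using openin_topspace[of pointwise_topology] by (simp only: openin_pointwise_topology)
  then have "topspace pointwise_topology \<subseteq> {f. bij f}" by (auto simp: pointwise_open_def)
  ultimately show ?thesis by blast
qed

lemma openin_pointwise_agree:
  assumes "finite F"
  shows "openin pointwise_topology {h. bij h \<and> (\<forall>x\<in>F. h x = g x)}"
  using assms unfolding openin_pointwise_topology pointwise_open_def by auto

lemma group_topology_pointwise: "group_topology S_infinity pointwise_topology"
  unfolding group_topology_S_infinity_iff
proof (intro conjI topspace_pointwise_topology)
  let ?T = pointwise_topology
  show "continuous_map (prod_topology ?T ?T) ?T (\<lambda>(f, g). f \<circ> g)"
    unfolding continuous_map_def
  proof (intro conjI allI impI)
    show "(\<lambda>(f, g). f \<circ> g) \<in> topspace (prod_topology ?T ?T) \<rightarrow> topspace ?T"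
      by (auto simp: topspace_pointwise_topology intro: bij_comp)
    fix S assume S: "openin ?T S"
    show "openin (prod_topology ?T ?T) {p \<in> topspace (prod_topology ?T ?T). (case p of (f, g) \<Rightarrow> f \<circ> g) \<in> S}"
      unfolding openin_prod_topology_alt
    proof (intro allI impI)
      fix f g
      assume "(f, g) \<in> {p \<in> topspace (prod_topology ?T ?T). (case p of (f, g) \<Rightarrow> f \<circ> g) \<in> S}"
      then have fg: "bij f" "bij g" "f \<circ> g \<in> S" by (auto simp: topspace_pointwise_topology)
      obtain F where F: "finite F" "\<And>h. bij h \<Longrightarrow> (\<And>x. x \<in> F \<Longrightarrow> h x = (f \<circ> g) x) \<Longrightarrow> h \<in> S"
        using pointwise_openE S fg(3) unfolding openin_pointwise_topology by blast
      let ?A = "{h. bij h \<and> (\<forall>x\<in>g ` F. h x = f x)}" and ?B = "{h. bij h \<and> (\<forall>x\<in>F. h x = g x)}"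
      have "openin ?T ?A" "openin ?T ?B" using F(1) by (intro openin_pointwise_agree; simp)+
      moreover have "f \<in> ?A" "g \<in> ?B" using fg by auto
      moreover have "?A \<times> ?B \<subseteq> {p \<in> topspace (prod_topology ?T ?T). (case p of (f, g) \<Rightarrow> f \<circ> g) \<in> S}"
        by (auto simp: topspace_pointwise_topology intro!: F(2) bij_comp)
      ultimately show "\<exists>U V. openin ?T U \<and> openin ?T V \<and> f \<in> U \<and> g \<in> V \<and>
          U \<times> V \<subseteq> {p \<in> topspace (prod_topology ?T ?T). (case p of (f, g) \<Rightarrow> f \<circ> g) \<in> S}"
        by blast
    qed
  qed
  show "continuous_map ?T ?T inv"
    unfolding continuous_map_def
  proof (intro conjI allI impI)
    show "inv \<in> topspace ?T \<rightarrow> topspace ?T"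
      by (auto simp: topspace_pointwise_topology bij_imp_bij_inv)
    fix S assume S: "openin ?T S"
    show "openin ?T {f \<in> topspace ?T. inv f \<in> S}"
      unfolding openin_pointwise_topology pointwise_open_def
    proof (intro ballI conjI)
      fix f assume "f \<in> {f \<in> topspace ?T. inv f \<in> S}"
      then have f: "bij f" "inv f \<in> S" by (auto simp: topspace_pointwise_topology)
      then show "bij f" by simp
      obtain F where F: "finite F" "\<And>h. bij h \<Longrightarrow> (\<And>x. x \<in> F \<Longrightarrow> h x = inv f x) \<Longrightarrow> h \<in> S"
        using pointwise_openE S f(2) unfolding openin_pointwise_topology by blast
      have "inv h \<in> S" if h: "bij h" "\<And>x. x \<in> inv f ` F \<Longrightarrow> h x = f x" for h
      proof (rule F(2))
        show "bij (inv h)" using h(1) by (rule bij_imp_bij_inv)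
        fix x assume "x \<in> F"
        then have "h (inv f x) = x" using h(2) bij_is_surj[OF f(1)] by (simp add: surj_f_inv_f)
        then show "inv h x = inv f x" using bij_is_inj[OF h(1)] by (metis inv_f_f)
      qed
      then show "\<exists>F. finite F \<and> (\<forall>h. bij h \<and> (\<forall>x\<in>F. h x = f x) \<longrightarrow> h \<in> {f \<in> topspace ?T. inv f \<in> S})"
        using F(1) by (intro exI[of _ "inv f ` F"]) (auto simp: topspace_pointwise_topology)
    qed
  qed
qed

text \<open>One permutation for each pair of lists that some permutation maps to each other: there are
  countably many such pairs, and they decide the values on every finite set.\<close>
lemma separable_pointwise: "separable_space pointwise_topology"
proof -
  define rep where "rep = (\<lambda>(xs, ys). SOME g :: nat \<Rightarrow> nat. bij g \<and> map g xs = ys)"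
  define C where "C = rep ` {(xs, ys). \<exists>g. bij g \<and> map g xs = ys}"
  have rep: "bij (rep (xs, map g xs)) \<and> map (rep (xs, map g xs)) xs = map g xs" if "bij g" for g xs
    unfolding rep_def prod.case by (rule someI[of _ g]) (use that in simp)
  have "countable C" unfolding C_def by simp
  moreover have "C \<subseteq> topspace pointwise_topology"
    using rep by (auto simp: C_def topspace_pointwise_topology)
  moreover have "g \<in> pointwise_topology closure_of C" if g: "bij g" for g
    unfolding in_closure_of
  proof (intro conjI allI impI)
    show "g \<in> topspace pointwise_topology" using g by (simp add: topspace_pointwise_topology)
    fix S assume "g \<in> S \<and> openin pointwise_topology S"
    then obtain F where F: "finite F" "\<And>h. bij h \<Longrightarrow> (\<And>x. x \<in> F \<Longrightarrow> h x = g x) \<Longrightarrow> h \<in> S"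
      using pointwise_openE unfolding openin_pointwise_topology by blast
    obtain xs where xs: "set xs = F" using F(1) finite_list by blast
    have "rep (xs, map g xs) \<in> S" using rep[OF g, of xs] xs by (intro F(2)) auto
    moreover have "rep (xs, map g xs) \<in> C" using g by (auto simp: C_def)
    ultimately show "\<exists>y. y \<in> C \<and> y \<in> S" by blast
  qed
  ultimately show ?thesis
    unfolding separable_space_def
    by (intro exI[of _ C]) (auto simp: topspace_pointwise_topology in_closure_of)
qed

lemma not_indiscrete_pointwise: "\<not> indiscrete_space pointwise_topology"
proof
  assume "indiscrete_space pointwise_topology"
  then have triv: "S = {} \<or> S = {f. bij f}" if "openin pointwise_topology S" for S
    using that by (auto simp: indiscrete_space_def topspace_pointwise_topology)
  let ?S = "{h::nat \<Rightarrow> nat. bij h \<and> (\<forall>x\<in>{0}. h x = id x)}"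
  let ?t = "Transposition.transpose 0 (1::nat)"
  have "id \<in> ?S" by simp
  moreover have "?t \<notin> ?S" "bij ?t" by simp_all
  ultimately show False using triv[OF openin_pointwise_agree[of "{0}" id]] by blast
qed

section \<open>Uniqueness\<close>

text \<open>Both inclusions follow by left translation from the two descriptions of the neighbourhoods of the
  identity.\<close>
lemma (in permutation_group_topology) eq_pointwise_topology:
  assumes sep: "separable_space T" and nontriv: "\<not> indiscrete_space T"
  shows "T = pointwise_topology"
  unfolding topology_eq openin_pointwise_topology
proof (intro allI iffI)
  fix S assume S: "openin T S"
  show "pointwise_open S"
    unfolding pointwise_open_def
  proof (intro ballI conjI)
    fix g assume g: "g \<in> S"
    then show bg: "bij g" using S openin_subset topspace by blast
    have "nbhd {h. bij h \<and> g \<circ> h \<in> S}"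
      using openin_left_translate[OF S bg] g by (simp add: nbhd_def)
    then obtain F where F: "finite F"
      "\<forall>f. bij f \<longrightarrow> (\<forall>x\<in>F. f x = x) \<longrightarrow> f \<in> {h. bij h \<and> g \<circ> h \<in> S}"
      by (rule nbhd_contains_stabilizer[OF sep])
    have "h \<in> S" if h: "bij h" "\<And>x. x \<in> F \<Longrightarrow> h x = g x" for h
    proof -
      have "inv g \<circ> h \<in> {h. bij h \<and> g \<circ> h \<in> S}"
      proof (intro F(2)[rule_format])
        show "bij (inv g \<circ> h)" by (intro bij_comp bij_imp_bij_inv bg h(1))
        show "(inv g \<circ> h) x = x" if "x \<in> F" for x using h(2)[OF that] bij_is_inj[OF bg] by simp
      qed
      moreover have "g \<circ> (inv g \<circ> h) = h"
        using bij_is_surj[OF bg] by (simp add: fun_eq_iff surj_f_inv_f)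
      ultimately show ?thesis by simp
    qed
    then show "\<exists>F. finite F \<and> (\<forall>h. bij h \<and> (\<forall>x\<in>F. h x = g x) \<longrightarrow> h \<in> S)"
      using F(1) by blast
  qed
next
  fix S assume S: "pointwise_open S"
  show "openin T S"
  proof (subst openin_subopen, intro ballI)
    fix g assume g: "g \<in> S"
    then have bg: "bij g" using S by (auto simp: pointwise_open_def)
    obtain F where F: "finite F" "\<And>h. bij h \<Longrightarrow> (\<And>x. x \<in> F \<Longrightarrow> h x = g x) \<Longrightarrow> h \<in> S"
      using pointwise_openE S g by blast
    obtain V where V: "nbhd V" "\<forall>v\<in>V. \<forall>x\<in>F. v x = x"
      by (rule nbhd_fixes_finite_set[OF sep nontriv F(1)])
    let ?N = "{h. bij h \<and> inv g \<circ> h \<in> V}"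
    have "openin T ?N"
      using V(1) bg by (intro openin_left_translate) (auto simp: nbhd_def bij_imp_bij_inv)
    moreover have "g \<in> ?N" using V(1) bg by (auto simp: nbhd_def bij_is_inj)
    moreover have "?N \<subseteq> S"
    proof
      fix h assume "h \<in> ?N"
      then have h: "bij h" "inv g \<circ> h \<in> V" by auto
      have "h x = g x" if "x \<in> F" for x
      proof -
        have "inv g (h x) = x" using V(2) h(2) that by fastforce
        then show ?thesis using surj_f_inv_f[OF bij_is_surj[OF bg], of "h x"] by simp
      qed
      then show "h \<in> S" using F(2) h(1) by blast
    qed
    ultimately show "\<exists>U. openin T U \<and> g \<in> U \<and> U \<subseteq> S" by blast
  qed
qed

theorem theorem1p11:
  shows "\<exists>!T. group_topology S_infinity T \<and> separable_space T \<and> \<not> indiscrete_space T"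
proof (rule ex1I)
  show "group_topology S_infinity pointwise_topology \<and> separable_space pointwise_topology
      \<and> \<not> indiscrete_space pointwise_topology"
    using group_topology_pointwise separable_pointwise not_indiscrete_pointwise by blast
next
  fix T assume T: "group_topology S_infinity T \<and> separable_space T \<and> \<not> indiscrete_space T"
  then interpret permutation_group_topology T by unfold_locales simp
  show "T = pointwise_topology" using T by (intro eq_pointwise_topology) auto
qed

end
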